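(* There exists a constant $c>0$ such that for all sufficiently small $\gamma>0$, and all sufficiently large $d,m\in\mathbb N$, there is a set $X$ and a set $F$ of functions from $X$ to $[0,1]$ such that $\mathrm{fatV}_F(\gamma)=d$ and $$\mathcal L(F,m)\ \ge\ \max\left\{c\,\frac{\mathrm{fatV}_F(\gamma)}{m},\ \gamma\right\}.$$
   Context: Prediction model: a prediction strategy for $X$ is a mapping $A$ from $\left(\bigcup_{k}(X\times[0,1])^k\right)\times X$ to $[0,1]$. For a set $F$ of functions from $X$ to $[0,1]$ and a positive integer $m$, $$\mathcal L(F,m)=\inf_A\ \sup_{D,f}\ \mathbf E_{(x_1,\dots,x_m)\sim D^m}\Big[\big|A\big(((x_1,f(x_1)),\dots,(x_{m-1},f(x_{m-1}))),x_m\big)-f(x_m)\big|\Big],$$ where the infimum is over all prediction strategies and the supremum is over all probability distributions $D$ on $X$ and all $f\in F$. Dimension: for $r\in[0,1]$, $\gamma>0$, define $\psi_{r,\gamma}:[0,1]\to\{0,\star,1\}$ by $\psi_{r,\gamma}(y)=1$ if $y\ge r+\gamma$, $\psi_{r,\gamma}(y)=0$ if $y\le r-\gamma$, and $\psi_{r,\gamma}(y)=\star$ if $|y-r|<\gamma$. A sequence $x_1,\dots,x_d\in X$ is $\gamma$-fatly Vapnik-shattered by $F$ if there is a single $r\in[0,1]$ with $\{0,1\}^d\subseteq\{(\psi_{r,\gamma}(f(x_1)),\dots,\psi_{r,\gamma}(f(x_d))):f\in F\}$. $\mathrm{fatV}_F(\gamma)$ is the length of the longest sequence $\gamma$-fatly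 Vapnik-shattered by $F$. Convention: issues of measurability are ignored; the reader may assume that $X$ is countable.
   Formalization: The formal theorem adds the condition d ≤ m; with d and m independently large the claim fails, since always predicting 1/2 gives L(F,m) ≤ 1/2 for every F, while c·d/m exceeds 1/2 once d > m/(2c). *)

theory Defs
  imports "HOL-Probability.Probability"
begin

(* Histories are lists of labelled examples; only values on X-carried arguments matter. *)
definition prediction_strategies :: "'a set \<Rightarrow> (('a \<times> real) list \<Rightarrow> 'a \<Rightarrow> real) set" where
  "prediction_strategies X =
     {A. \<forall>s x. set s \<subseteq> X \<times> {0..1} \<longrightarrow> x \<in> X \<longrightarrow> A s x \<in> {0..1}}"

definition expected_error ::
    "(('a \<times> real) list \<Rightarrow> 'a \<Rightarrow> real) \<Rightarrow> nat \<Rightarrow> 'a pmf \<Rightarrow> ('a \<Rightarrow> real) \<Rightarrow> real" where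
  "expected_error A m D f =
     measure_pmf.expectation (replicate_pmf m D)
       (\<lambda>xs. \<bar>A (map (\<lambda>x. (x, f x)) (butlast xs)) (last xs) - f (last xs)\<bar>)"

(* X is meant to be countable, so that its probability distributions are exactly the
   pmfs supported in X and no measurability questions arise.  The infimum and supremum
   are those of the reals: for m > 0, nonempty X and nonempty F \<subseteq> X \<rightarrow> [0,1], they range
   over nonempty subsets of [0,1].  The constant strategy 1/2 shows that the value is
   then at most 1/2, so a lower bound of order d / m is possible only when d = O(m). *)
definition prediction_loss :: "'a set \<Rightarrow> ('a \<Rightarrow> real) set \<Rightarrow> nat \<Rightarrow> real" where
  "prediction_loss X F m =
     (INF A \<in> prediction_strategies X.
        SUP (D, f) \<in> {D. set_pmf D \<subseteq> X} \<times> F. expected_error A m D f)"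

(* Some True, Some False and None encode the values 1, 0 and star. *)
definition fat_threshold :: "real \<Rightarrow> real \<Rightarrow> real \<Rightarrow> bool option" where
  "fat_threshold r \<gamma> y =
     (if y \<ge> r + \<gamma> then Some True else if y \<le> r - \<gamma> then Some False else None)"

definition fatly_V_shattered :: "('a \<Rightarrow> real) set \<Rightarrow> real \<Rightarrow> 'a list \<Rightarrow> bool" where
  "fatly_V_shattered F \<gamma> xs \<longleftrightarrow>
     (\<exists>r\<in>{0..1}. \<forall>bs :: bool list. length bs = length xs \<longrightarrow>
        (\<exists>f\<in>F. map (\<lambda>x. fat_threshold r \<gamma> (f x)) xs = map Some bs))"

(* The value is \<infinity> if arbitrarily long sequences are shattered. *)
definition fatV :: "'a set \<Rightarrow> ('a \<Rightarrow> real) set \<Rightarrow> real \<Rightarrow> enat" where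
  "fatV X F \<gamma> = (SUP xs \<in> {xs. set xs \<subseteq> X \<and> fatly_V_shattered F \<gamma> xs}. enat (length xs))"

end

theory Submission
  imports Defs
begin

text \<open>
  The class consists of all functions with f x in {lo x, hi x} on the natural numbers. The first
  d - 1 points carry the values 0 and 1; every later point carries two values at distance exactly
  2 \<gamma>, with pairwise distinct lower values. Such a point is shattered only by the threshold in
  the middle of its two values, so each threshold shatters at most one of them, and the dimension
  is exactly d.

  If f is chosen at random, a point x not seen before costs at least (hi x - lo x) / 2 on average.
  Under a distribution with mass 1 / (2 m) on each of the first d - 1 points, the last point is one
  of these and new with probability at least (d - 1) / (4 m). Under the uniform distribution on
  many later points it is new with probability tending to 1, so the loss is at least \<gamma>.
\<close>

section \<open>Probability that the last draw is new\<close>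

lemma prob_pair_pmf_Times:
  "measure_pmf.prob (pair_pmf M N) (A \<times> B) = measure_pmf.prob M A * measure_pmf.prob N B"
proof -
  have "emeasure (measure_pmf (pair_pmf M N)) (A \<times> B)
      = (\<integral>\<^sup>+x. \<integral>\<^sup>+y. indicator A x * indicator B y \<partial>N \<partial>M)"
    by (simp add: nn_integral_pair_pmf' indicator_times flip: nn_integral_indicator)
  also have "\<dots> = emeasure (measure_pmf M) A * emeasure (measure_pmf N) B"
    by (simp add: nn_integral_cmult nn_integral_multc)
  finally show ?thesis
    by (simp add: measure_def enn2real_mult)
qed

lemma prob_fresh_replicate_pmf:
  "measure_pmf.prob (replicate_pmf n D) {xs. x \<notin> set xs} = (1 - pmf D x) ^ n"
proof (induction n)
  case 0
  then show ?case by simp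
next
  case (Suc n)
  have "replicate_pmf (Suc n) D = map_pmf (\<lambda>(y, ys). y # ys) (pair_pmf D (replicate_pmf n D))"
    by (simp add: pair_pmf_def map_bind_pmf)
  then have "measure_pmf.prob (replicate_pmf (Suc n) D) {xs. x \<notin> set xs}
      = measure_pmf.prob (pair_pmf D (replicate_pmf n D)) ((- {x}) \<times> {xs. x \<notin> set xs})"
    by (simp only: measure_map_pmf) (auto intro!: arg_cong2[where f = measure_pmf.prob])
  also have "\<dots> = measure_pmf.prob D (- {x}) * (1 - pmf D x) ^ n"
    using Suc by (simp add: prob_pair_pmf_Times)
  also have "measure_pmf.prob D (- {x}) = 1 - pmf D x"
    using measure_pmf.prob_compl[of "{x}" D] by (simp add: Compl_eq_Diff_UNIV measure_pmf_single)
  finally show ?case by simp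
qed

text \<open>The last draw is independent of the \<open>n\<close> earlier ones. For different
  \<open>x\<close> these events are disjoint, so their sum over a set is the probability that the
  last point is a new member of it.\<close>

lemma prob_last_fresh_replicate_pmf:
  "measure_pmf.prob (replicate_pmf (Suc n) D) {xs. last xs = x \<and> x \<notin> set (butlast xs)}
     = pmf D x * (1 - pmf D x) ^ n"
proof -
  have "replicate_pmf (Suc n) D = map_pmf (\<lambda>(ys, y). ys @ [y]) (pair_pmf (replicate_pmf n D) D)"
    using replicate_pmf_distrib[of n 1 D]
    by (simp add: pair_pmf_def map_bind_pmf bind_assoc_pmf bind_return_pmf replicate_pmf_1 bind_map_pmf)
  then have "measure_pmf.prob (replicate_pmf (Suc n) D) {xs. last xs = x \<and> x \<notin> set (butlast xs)}
      = measure_pmf.prob (pair_pmf (replicate_pmf n D) D) ({xs. x \<notin> set xs} \<times> {x})"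
    by (simp only: measure_map_pmf) (auto intro!: arg_cong2[where f = measure_pmf.prob])
  also have "\<dots> = (1 - pmf D x) ^ n * pmf D x"
    by (simp add: prob_pair_pmf_Times prob_fresh_replicate_pmf measure_pmf_single)
  finally show ?thesis by simp
qed

section \<open>Lower bound on the loss of a two-valued class\<close>

lemma prediction_error_bounds:
  assumes "A \<in> prediction_strategies UNIV" "range f \<subseteq> {0..1}"
  shows "\<bar>A (map (\<lambda>x. (x, f x)) ys) x - f x\<bar> \<le> 1"
proof -
  have f: "f y \<in> {0..1}" for y
    using assms(2) by blast
  then have "set (map (\<lambda>x. (x, f x)) ys) \<subseteq> UNIV \<times> {0..1}"
    by auto
  then have "A (map (\<lambda>x. (x, f x)) ys) x \<in> {0..1}"
    using assms(1) unfolding prediction_strategies_def by blast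
  then show ?thesis
    using f[of x] by auto
qed

lemma expected_error_le_1:
  assumes "A \<in> prediction_strategies UNIV" "range f \<subseteq> {0..1}"
  shows "expected_error A m D f \<le> 1"
  unfolding expected_error_def
  by (rule measure_pmf.integral_le_const)
     (auto intro!: measure_pmf.integrable_const_bound[where B = 1] AE_pmfI prediction_error_bounds[OF assms])

text \<open>Targets \<open>B\<close> and \<open>insert x B\<close> look alike until \<open>x\<close>
  has been seen, so on a new point any strategy loses at least \<open>w\<close> on the two together.
  Some \<open>B\<close> does at least as badly as the average over all subsets of \<open>S\<close>,
  whence the factor \<open>w / 2\<close>.\<close>

lemma exists_hard_target:
  fixes lo hi :: "'a \<Rightarrow> real"
  assumes A: "A \<in> prediction_strategies UNIV"
    and bounds: "\<And>x. lo x \<in> {0..1}" "\<And>x. hi x \<in> {0..1}"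
    and "finite S" and "0 \<le> w" and gap: "\<And>x. x \<in> S \<Longrightarrow> w \<le> hi x - lo x"
  shows "\<exists>B\<subseteq>S. w / 2 * (\<Sum>x\<in>S. pmf D x * (1 - pmf D x) ^ n)
           \<le> expected_error A (Suc n) D (\<lambda>x. if x \<in> B then hi x else lo x)"
proof -
  define f where "f B x = (if x \<in> B then hi x else lo x)" for B x
  define err where
    "err B xs = \<bar>A (map (\<lambda>x. (x, f B x)) (butlast xs)) (last xs) - f B (last xs)\<bar>" for B xs
  define E where "E x = {xs. last xs = x \<and> x \<notin> set (butlast xs)}" for x :: 'a
  let ?R = "replicate_pmf (Suc n) D"
  have f_range: "range (f B) \<subseteq> {0..1}" for B
    using bounds by (auto simp: f_def)
  have err_int: "integrable (measure_pmf ?R) (err B)" for B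
    by (rule measure_pmf.integrable_const_bound[where B = 1])
       (auto simp: err_def intro!: prediction_error_bounds[OF A f_range])
  have ind_int: "integrable (measure_pmf ?R) (indicator (E x) :: _ \<Rightarrow> real)" for x
    by (rule measure_pmf.integrable_const_bound[where B = 1]) auto
  \<comment> \<open>Pointwise in \<open>xs\<close>, the indicator sum is 1 if the last point is a
    new member of \<open>S\<close> and 0 otherwise.\<close>
  have avg: "2 ^ card S * (w / 2) * (\<Sum>x\<in>S. indicator (E x) xs) \<le> (\<Sum>B\<in>Pow S. err B xs)" for xs
  proof (cases "last xs \<in> S \<and> last xs \<notin> set (butlast xs)")
    case False
    then have "(\<Sum>x\<in>S. indicator (E x) xs) = (0 :: real)"
      by (intro sum.neutral) (auto simp: E_def indicator_def)
    moreover have "0 \<le> (\<Sum>B\<in>Pow S. err B xs)"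
      by (intro sum_nonneg) (simp add: err_def)
    ultimately show ?thesis by simp
  next
    case True
    define x where "x = last xs"
    have x: "x \<in> S" "x \<notin> set (butlast xs)" using True by (auto simp: x_def)
    have "(\<Sum>y\<in>S. indicator (E y) xs) = (\<Sum>y\<in>S. if y = x then 1 else 0 :: real)"
      using x by (intro sum.cong) (auto simp: E_def indicator_def x_def)
    then have one: "(\<Sum>y\<in>S. indicator (E y) xs) = (1 :: real)"
      using x \<open>finite S\<close> by simp
    let ?T = "S - {x}"
    \<comment> \<open>As \<open>x\<close> is absent from the history, both targets elicit the same
      prediction, and the triangle inequality applies.\<close>
    have pair: "w \<le> err B xs + err (insert x B) xs" if "B \<in> Pow ?T" for B
    proof -
      have same_history:
        "map (\<lambda>y. (y, f (insert x B) y)) (butlast xs) = map (\<lambda>y. (y, f B y)) (butlast xs)"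
        using x by (auto simp: f_def)
      moreover have "f B x = lo x" "f (insert x B) x = hi x"
        using that by (auto simp: f_def)
      ultimately show ?thesis
        using gap[OF x(1)] unfolding err_def x_def[symmetric] same_history by linarith
    qed
    have card: "card S = Suc (card ?T)"
      using x \<open>finite S\<close> by (metis card_Suc_Diff1)
    have "2 ^ card S * (w / 2) = (\<Sum>B\<in>Pow ?T. w)"
      using \<open>finite S\<close> by (simp add: card card_Pow)
    also have "\<dots> \<le> (\<Sum>B\<in>Pow ?T. err B xs + err (insert x B) xs)"
      by (intro sum_mono pair)
    also have "\<dots> = (\<Sum>B\<in>Pow ?T. err B xs) + (\<Sum>B\<in>insert x ` Pow ?T. err B xs)"
      by (subst sum.reindex) (auto simp: sum.distrib inj_on_def)
    also have "\<dots> = (\<Sum>B\<in>Pow ?T \<union> insert x ` Pow ?T. err B xs)"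
      using \<open>finite S\<close> by (intro sum.union_disjoint[symmetric]) auto
    also have "Pow ?T \<union> insert x ` Pow ?T = Pow S"
      using x by (metis Pow_insert insert_Diff)
    finally show ?thesis by (simp add: one)
  qed
  define L where "L = w / 2 * (\<Sum>x\<in>S. pmf D x * (1 - pmf D x) ^ n)"
  have "(\<Sum>B\<in>Pow S. L) = 2 ^ card S * (w / 2) * (\<Sum>x\<in>S. measure_pmf.prob ?R (E x))"
    using \<open>finite S\<close>
    unfolding E_def prob_last_fresh_replicate_pmf by (simp add: L_def card_Pow)
  also have "\<dots> = measure_pmf.expectation ?R (\<lambda>xs. 2 ^ card S * (w / 2) * (\<Sum>x\<in>S. indicator (E x) xs))"
    using ind_int by simp
  also have "\<dots> \<le> measure_pmf.expectation ?R (\<lambda>xs. \<Sum>B\<in>Pow S. err B xs)"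
    using ind_int err_int avg by (intro integral_mono) auto
  also have "\<dots> = (\<Sum>B\<in>Pow S. expected_error A (Suc n) D (f B))"
    using err_int unfolding expected_error_def err_def by (intro Bochner_Integration.integral_sum)
  finally have "\<exists>B\<in>Pow S. L \<le> expected_error A (Suc n) D (f B)"
    using \<open>finite S\<close> by (metis (lifting) Pow_not_empty finite_Pow_iff not_le sum_strict_mono)
  then show ?thesis unfolding L_def f_def by auto
qed

text \<open>Only the target depends on the strategy, while \<open>D\<close> is fixed beforehand, so
  the bound passes to the infimum over strategies.\<close>

lemma binary_class_loss:
  fixes lo hi :: "'a \<Rightarrow> real"
  assumes bounds: "\<And>x. lo x \<in> {0..1}" "\<And>x. hi x \<in> {0..1}"
    and "finite S" and "0 \<le> w" and "\<And>x. x \<in> S \<Longrightarrow> w \<le> hi x - lo x"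
  shows "w / 2 * (\<Sum>x\<in>S. pmf D x * (1 - pmf D x) ^ n)
           \<le> prediction_loss UNIV (\<Pi>\<^sub>E x\<in>UNIV. {lo x, hi x}) (Suc n)"
  unfolding prediction_loss_def
proof (rule cINF_greatest)
  show "prediction_strategies (UNIV :: 'a set) \<noteq> {}"
    by (auto simp: prediction_strategies_def intro!: exI[of _ "\<lambda>_ _. 0"])
next
  fix A assume A: "A \<in> prediction_strategies (UNIV :: 'a set)"
  let ?F = "\<Pi>\<^sub>E x\<in>UNIV. {lo x, hi x}"
  obtain B where B: "w / 2 * (\<Sum>x\<in>S. pmf D x * (1 - pmf D x) ^ n)
      \<le> expected_error A (Suc n) D (\<lambda>x. if x \<in> B then hi x else lo x)"
    using exists_hard_target[of A lo hi S w, OF A assms] by blast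
  have F_range: "range f \<subseteq> {0..1}" if "f \<in> ?F" for f
  proof -
    have "f x \<in> {lo x, hi x}" for x using that by (auto simp: PiE_def Pi_def)
    then show ?thesis using bounds by (metis image_subsetI insertE singletonD)
  qed
  \<comment> \<open>A real supremum dominates its members only if they are bounded above, which
    \<open>expected_error_le_1\<close> supplies.\<close>
  have "expected_error A (Suc n) D (\<lambda>x. if x \<in> B then hi x else lo x)
      \<le> (SUP (D, f)\<in>{D. set_pmf D \<subseteq> UNIV} \<times> ?F. expected_error A (Suc n) D f)"
    by (rule cSUP_upper2[where x = "(D, \<lambda>x. if x \<in> B then hi x else lo x)"])
       (auto intro!: bdd_aboveI2[where M = 1] expected_error_le_1[OF A F_range] simp: PiE_def Pi_def)
  with B show "w / 2 * (\<Sum>x\<in>S. pmf D x * (1 - pmf D x) ^ n)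
      \<le> (SUP (D, f)\<in>{D. set_pmf D \<subseteq> UNIV} \<times> ?F. expected_error A (Suc n) D f)"
    by linarith
qed

section \<open>Shattering by a two-valued class\<close>

text \<open>Values at different points are chosen independently, so all label patterns arise once
  each point has one value on each side of the margin around a common \<open>r\<close>. A repeated
  point cannot take two labels.\<close>

lemma binary_class_shattered_iff:
  fixes lo hi :: "'a \<Rightarrow> real"
  assumes "0 < \<gamma>"
    and "\<And>x. lo x \<le> hi x"
  shows "fatly_V_shattered (\<Pi>\<^sub>E x\<in>UNIV. {lo x, hi x}) \<gamma> xs \<longleftrightarrow>
    distinct xs \<and> (\<exists>r\<in>{0..1}. \<forall>x\<in>set xs. lo x \<le> r - \<gamma> \<and> r + \<gamma> \<le> hi x)"
    (is "?L \<longleftrightarrow> ?R")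
proof
  assume ?L
  then obtain r where r: "r \<in> {0..1}"
    and sh: "\<And>bs :: bool list. length bs = length xs \<Longrightarrow>
      \<exists>f\<in>\<Pi>\<^sub>E x\<in>UNIV. {lo x, hi x}. map (\<lambda>x. fat_threshold r \<gamma> (f x)) xs = map Some bs"
    unfolding fatly_V_shattered_def by blast
  \<comment> \<open>\<open>P\<close> labels positions rather than points, so a repeated point can be
    asked for contradictory labels; a constant \<open>P\<close> shows that both sides of the margin
    are reached.\<close>
  have *: "\<exists>f\<in>\<Pi>\<^sub>E x\<in>UNIV. {lo x, hi x}. \<forall>i<length xs. fat_threshold r \<gamma> (f (xs ! i)) = Some (P i)" for P
  proof -
    obtain f where f: "f \<in> (\<Pi>\<^sub>E x\<in>UNIV. {lo x, hi x})"
      "map (\<lambda>x. fat_threshold r \<gamma> (f x)) xs = map Some (map P [0..<length xs])"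
      using sh[of "map P [0..<length xs]"] by auto
    have "fat_threshold r \<gamma> (f (xs ! i)) = Some (P i)" if "i < length xs" for i
      using arg_cong[OF f(2), of "\<lambda>ys. ys ! i"] that by simp
    with f(1) show ?thesis by blast
  qed
  have "distinct xs"
    unfolding distinct_conv_nth
  proof (intro allI impI notI)
    fix i j assume ij: "i < length xs" "j < length xs" "i \<noteq> j" "xs ! i = xs ! j"
    obtain f where "\<forall>k<length xs. fat_threshold r \<gamma> (f (xs ! k)) = Some (k = i)"
      using *[of "\<lambda>k. k = i"] by blast
    with ij show False by (metis option.inject)
  qed
  moreover have "lo x \<le> r - \<gamma> \<and> r + \<gamma> \<le> hi x" if "x \<in> set xs" for x
  proof -
    obtain i where i: "i < length xs" "xs ! i = x"
      using \<open>x \<in> set xs\<close> unfolding in_set_conv_nth by blast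
    have "\<exists>y\<in>{lo x, hi x}. fat_threshold r \<gamma> y = Some b" for b
      using *[of "\<lambda>_. b"] i by (metis PiE_mem UNIV_I)
    from this[of True] this[of False] show ?thesis
      using assms(1) assms(2)[of x] by (auto simp: fat_threshold_def split: if_splits)
  qed
  ultimately show ?R using r by blast
next
  assume ?R
  then obtain r where r: "r \<in> {0..1}" "distinct xs"
    "\<And>x. x \<in> set xs \<Longrightarrow> lo x \<le> r - \<gamma> \<and> r + \<gamma> \<le> hi x" by blast
  show ?L
    unfolding fatly_V_shattered_def
  proof (intro bexI[OF _ r(1)] allI impI)
    fix bs :: "bool list" assume len: "length bs = length xs"
    \<comment> \<open>Distinctness makes the lookup return the label of each position; points
      outside \<open>xs\<close> get the lower value.\<close>
    define f where "f x = (if map_of (zip xs bs) x = Some True then hi x else lo x)" for x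
    have "fat_threshold r \<gamma> (f (xs ! i)) = Some (bs ! i)" if "i < length xs" for i
      using that len r(2) r(3)[of "xs ! i"] assms(1)
      by (auto simp: f_def map_of_zip_nth fat_threshold_def)
    then show "\<exists>f\<in>\<Pi>\<^sub>E x\<in>UNIV. {lo x, hi x}. map (\<lambda>x. fat_threshold r \<gamma> (f x)) xs = map Some bs"
      using len by (intro bexI[of _ f]) (auto simp: list_eq_iff_nth_eq f_def)
  qed
qed

section \<open>The class, its dimension and its two hard distributions\<close>

theorem theorem5:
  "\<exists>c>0. \<exists>\<gamma>\<^sub>0>0. \<exists>d\<^sub>0 m\<^sub>0 :: nat.
     \<forall>(\<gamma>::real) (d::nat) (m::nat).
       0 < \<gamma> \<longrightarrow> \<gamma> \<le> \<gamma>\<^sub>0 \<longrightarrow> d\<^sub>0 \<le> d \<longrightarrow> m\<^sub>0 \<le> m \<longrightarrow> d \<le> m \<longrightarrow>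
       (\<exists>(X :: nat set) (F :: (nat \<Rightarrow> real) set).
          F \<subseteq> (X \<rightarrow>\<^sub>E {0..1}) \<and>
          fatV X F \<gamma> = enat d \<and>
          prediction_loss X F m
            \<ge> max (c * real (the_enat (fatV X F \<gamma>)) / real m) \<gamma>)"
proof -
  have "\<exists>(X :: nat set) (F :: (nat \<Rightarrow> real) set).
          F \<subseteq> (X \<rightarrow>\<^sub>E {0..1}) \<and>
          fatV X F \<gamma> = enat d \<and>
          prediction_loss X F m
            \<ge> max (1 / 16 * real (the_enat (fatV X F \<gamma>)) / real m) \<gamma>"
    if \<gamma>: "0 < \<gamma>" "\<gamma> \<le> 1 / 4" and d: "2 \<le> d" and m: "1 \<le> m" and dm: "d \<le> m"
    for \<gamma> :: real and d m :: nat
  proof -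
    define k where "k = d - 1"
    obtain n where n: "m = Suc n" using m by (cases m) auto
    \<comment> \<open>The function \<open>1 / (real x + 2)\<close> is injective and at most 1/2, so
      \<open>\<gamma> \<le> 1 / 4\<close> keeps \<open>hi x\<close> in the unit interval.\<close>
    define lo :: "nat \<Rightarrow> real" where "lo x = (if x < k then 0 else 1 / (real x + 2))" for x
    define hi :: "nat \<Rightarrow> real" where "hi x = (if x < k then 1 else lo x + 2 * \<gamma>)" for x
    have lo_half: "0 \<le> lo x \<and> lo x \<le> 1 / 2" for x by (auto simp: lo_def field_simps)
    have lo: "lo x \<in> {0..1}" for x using lo_half[of x] by simp
    have hi: "hi x \<in> {0..1}" for x using lo_half[of x] \<gamma> by (simp add: hi_def)
    have lo_hi: "lo x \<le> hi x" for x using lo[of x] \<gamma> by (auto simp: hi_def)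
    define F where "F = (\<Pi>\<^sub>E x\<in>UNIV. {lo x, hi x})"
    note shattered_iff = binary_class_shattered_iff[of \<gamma> lo hi, OF \<gamma>(1) lo_hi, folded F_def]
    have "F \<subseteq> (UNIV \<rightarrow>\<^sub>E {0..1})"
      unfolding F_def using lo hi by (intro PiE_mono) auto
    moreover have fatV: "fatV UNIV F \<gamma> = enat d"
    proof (rule antisym)
      show "fatV UNIV F \<gamma> \<le> enat d"
        unfolding fatV_def
      proof (rule SUP_least)
        fix xs assume "xs \<in> {xs. set xs \<subseteq> UNIV \<and> fatly_V_shattered F \<gamma> xs}"
        then obtain r where dist: "distinct xs"
          and r: "\<And>x. x \<in> set xs \<Longrightarrow> lo x \<le> r - \<gamma> \<and> r + \<gamma> \<le> hi x"
          unfolding shattered_iff by blast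
        \<comment> \<open>A gap of exactly \<open>2 * \<gamma>\<close> leaves no slack around
          \<open>r\<close>, so all later points of \<open>xs\<close> share their lower value and
          hence coincide.\<close>
        have "lo x = r - \<gamma>" if "x \<in> set xs - {..<k}" for x
          using r[of x] that by (auto simp: hi_def)
        then have "\<forall>x\<in>set xs - {..<k}. \<forall>y\<in>set xs - {..<k}. lo x = lo y" by simp
        then have "\<forall>x\<in>set xs - {..<k}. \<forall>y\<in>set xs - {..<k}. x = y" by (auto simp: lo_def)
        then have "card (set xs - {..<k}) \<le> 1" by (auto simp: card_le_Suc0_iff_eq)
        then have "card (set xs) \<le> d"
          using card_mono[of "{..<k} \<union> (set xs - {..<k})" "set xs"]
            card_Un_le[of "{..<k}" "set xs - {..<k}"] d
          by (auto simp: k_def)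
        then show "enat (length xs) \<le> enat d"
          using distinct_card[OF dist] by simp
      qed
      \<comment> \<open>The midpoint \<open>lo k + \<gamma>\<close> is the only threshold that the
        point \<open>k\<close> admits. It also separates the values 0 and 1 below \<open>k\<close>,
        since \<open>lo k + 2 * \<gamma> \<le> 1\<close>.\<close>
      have "fatly_V_shattered F \<gamma> [0..<d]"
        unfolding shattered_iff
      proof (intro conjI bexI[of _ "lo k + \<gamma>"] ballI)
        fix x assume "x \<in> set [0..<d]"
        then have "x < k \<or> x = k" by (auto simp: k_def)
        then show "lo x \<le> lo k + \<gamma> - \<gamma>" "lo k + \<gamma> + \<gamma> \<le> hi x"
          using lo_half[of k] \<gamma> by (auto simp: hi_def, simp add: lo_def)
      qed (use lo_half[of k] \<gamma> in auto)
      then show "enat d \<le> fatV UNIV F \<gamma>"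
        unfolding fatV_def by (intro SUP_upper2[of "[0..<d]"]) auto
    qed
    moreover have "1 / 16 * real d / real m \<le> prediction_loss UNIV F m"
    proof -
      \<comment> \<open>Clipping at \<open>k\<close> puts mass \<open>1 / (2 * real m)\<close> on
        each point below \<open>k\<close> and the rest on \<open>k\<close>; here
        \<open>k < 2 * m\<close> because \<open>d \<le> m\<close>.\<close>
      define D where "D = map_pmf (\<lambda>i. min i k) (pmf_of_set {..<2 * m})"
      have D: "pmf D x = 1 / (2 * real m)" if "x < k" for x
      proof -
        have "{..<2 * m} \<inter> (\<lambda>i. min i k) -` {x} = {x}"
          using that d dm by (auto simp: k_def min_def split: if_splits)
        then show ?thesis
          using m by (simp add: D_def pmf_map measure_pmf_of_set lessThan_empty_iff)
      qed
      \<comment> \<open>By Bernoulli, a point below \<open>k\<close> escapes the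
        \<open>n < m\<close> earlier draws with probability at least 1/2.\<close>
      have "1 + real n * (- (1 / (2 * real m))) \<le> (1 + (- (1 / (2 * real m)))) ^ n"
        by (rule Bernoulli_inequality) (use m in \<open>auto simp: field_simps\<close>)
      moreover have "1 / 2 \<le> 1 + real n * (- (1 / (2 * real m)))"
        using n by (simp add: field_simps)
      ultimately have half: "1 / 2 \<le> (1 - 1 / (2 * real m)) ^ n"
        by simp
      \<comment> \<open>Averaging, mass and freshness contribute a factor 1/2 each; the fourth comes
        from \<open>real k \<ge> real d / 2\<close>, valid for \<open>d \<ge> 2\<close>.\<close>
      have "1 / 16 * real d / real m \<le> 1 / 2 * (real k * (1 / (2 * real m) * (1 / 2)))"
        using d m by (simp add: k_def field_simps)
      also have "\<dots> \<le> 1 / 2 * (real k * (1 / (2 * real m) * (1 - 1 / (2 * real m)) ^ n))"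
        using half by (intro mult_left_mono) auto
      also have "\<dots> = 1 / 2 * (\<Sum>x<k. pmf D x * (1 - pmf D x) ^ n)"
        by (simp add: D)
      also have "\<dots> \<le> prediction_loss UNIV F m"
        unfolding F_def n by (rule binary_class_loss[OF lo hi]) (auto simp: lo_def hi_def)
      finally show ?thesis .
    qed
    \<comment> \<open>Each \<open>N\<close> gives \<open>\<gamma>\<close> only up to the factor
      \<open>(1 - 1 / real (Suc N)) ^ n\<close>. The class stays fixed as \<open>N\<close> grows, so
      the limit yields \<open>\<gamma>\<close> itself.\<close>
    moreover have "\<gamma> \<le> prediction_loss UNIV F m"
    proof (rule LIMSEQ_le_const2)
      have "(\<lambda>N. \<gamma> * (1 - 1 / real (Suc N)) ^ n) \<longlonglongrightarrow> \<gamma> * (1 - 0) ^ n"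
        by (intro tendsto_intros LIMSEQ_Suc[OF lim_1_over_n])
      then show "(\<lambda>N. \<gamma> * (1 - 1 / real (Suc N)) ^ n) \<longlonglongrightarrow> \<gamma>" by simp
      have "\<gamma> * (1 - 1 / real (Suc N)) ^ n \<le> prediction_loss UNIV F m" for N
      proof -
        \<comment> \<open>This set has \<open>Suc N\<close> points, so it is nonempty for every
          \<open>N\<close>, and each has gap \<open>2 * \<gamma>\<close>.\<close>
        let ?S = "{k..k + N}"
        have "\<gamma> * (1 - 1 / real (Suc N)) ^ n
            = 2 * \<gamma> / 2 * (\<Sum>x\<in>?S. pmf (pmf_of_set ?S) x * (1 - pmf (pmf_of_set ?S) x) ^ n)"
          by simp
        also have "\<dots> \<le> prediction_loss UNIV F m"
          unfolding F_def n by (rule binary_class_loss[OF lo hi]) (use \<gamma> in \<open>auto simp: hi_def\<close>)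
        finally show ?thesis .
      qed
      then show "\<exists>M. \<forall>N\<ge>M. \<gamma> * (1 - 1 / real (Suc N)) ^ n \<le> prediction_loss UNIV F m" by blast
    qed
    ultimately show ?thesis
      by (intro exI[of _ UNIV] exI[of _ F]) simp
  qed
  then show ?thesis
    by (intro exI[of _ "1 / 16"] exI[of _ "1 / 4"] exI[of _ 2] exI[of _ 1] conjI) auto
qed

end
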